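(* Let $(X,\tau)$ be a metrizable space and let $F=\{a_1,\dots,a_k\}\subseteq X$ be a set of $k$ distinct points, $2\le k<\infty$. Let $s,t\in\mathcal G_F(\tau)$ and put $m_i=\min\{s_i,t_i\}$ for $i=1,\dots,k$. The minimum system $m=(m_1,\dots,m_k)$ is incompatible (i.e. $\inf_{x\in X}\max\{m_i(x),m_j(x)\}=0$ for some $i\ne j$) if and only if there are distinct indices $i,j$ and a sequence $(x_n)$ in $X$ such that, after possibly interchanging $s$ and $t$, $$s_i(x_n)\longrightarrow0,\qquad t_j(x_n)\longrightarrow0.$$ This last condition on the sequence is equivalent to: $x_n\to a_i$ in $\tau_s$ and $x_n\to a_j$ in $\tau_t$.
   Context: A compatible gauge system at $F$ is a $k$-tuple $s=(s_1,\dots,s_k)$ of $\tau$-continuous functions $s_i:X\to[0,1]$ with $s_i^{-1}(0)=\{a_i\}$ for all $i$ and $\inf_{x\in X}\max\{s_i(x),s_j(x)\}>0$ for all $i\ne j$. $\mathcal G_F(\tau)$ is the class of all compatible gauge systems at $F$. For $s\in\mathcal G_F(\tau)$, $\tau_s$ is the topology on $X$ in which $U\subseteq X$ is open exactly when $U\in\tau$ and, for every $i$ with $a_i\in U$, there is $\varepsilon_i>0$ such that $\{x: s_i(x)<\varepsilon_i\}\subseteq U$. *)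

theory Defs
  imports "HOL-Analysis.Analysis"
begin

text \<open>
  The space \<open>(X, \<tau>)\<close> is a topology \<open>\<tau>\<close> with \<open>X = topspace \<tau>\<close>, and the points of
  \<open>F = {a\<^sub>1, \<dots>, a\<^sub>k}\<close> are given by their enumeration \<open>a\<close> on \<open>{1..k}\<close>. A \<open>k\<close>-tuple of functions
  on \<open>X\<close> is a family \<open>s :: nat \<Rightarrow> 'a \<Rightarrow> real\<close>, of which only the values at indices in \<open>{1..k}\<close> and
  points in \<open>topspace \<tau>\<close> are relevant.
\<close>

definition compatible_gauge_systems ::
    "'a topology \<Rightarrow> nat \<Rightarrow> (nat \<Rightarrow> 'a) \<Rightarrow> (nat \<Rightarrow> 'a \<Rightarrow> real) set" where
  "compatible_gauge_systems \<tau> k a =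
    {s. (\<forall>i\<in>{1..k}. continuous_map \<tau> (top_of_set {0..1}) (s i)
                      \<and> {x \<in> topspace \<tau>. s i x = 0} = {a i})
      \<and> (\<forall>i\<in>{1..k}. \<forall>j\<in>{1..k}. i \<noteq> j \<longrightarrow>
            (INF x\<in>topspace \<tau>. max (s i x) (s j x)) > 0)}"

definition incompatible_system ::
    "'a topology \<Rightarrow> nat \<Rightarrow> (nat \<Rightarrow> 'a \<Rightarrow> real) \<Rightarrow> bool" where
  "incompatible_system \<tau> k m \<longleftrightarrow>
    (\<exists>i\<in>{1..k}. \<exists>j\<in>{1..k}. i \<noteq> j \<and> (INF x\<in>topspace \<tau>. max (m i x) (m j x)) = 0)"

definition min_system ::
    "(nat \<Rightarrow> 'a \<Rightarrow> real) \<Rightarrow> (nat \<Rightarrow> 'a \<Rightarrow> real) \<Rightarrow> nat \<Rightarrow> 'a \<Rightarrow> real" where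
  "min_system s t = (\<lambda>i x. min (s i x) (t i x))"

definition gauge_topology ::
    "'a topology \<Rightarrow> nat \<Rightarrow> (nat \<Rightarrow> 'a) \<Rightarrow> (nat \<Rightarrow> 'a \<Rightarrow> real) \<Rightarrow> 'a topology" where
  "gauge_topology \<tau> k a s = topology (\<lambda>U. openin \<tau> U \<and>
    (\<forall>i\<in>{1..k}. a i \<in> U \<longrightarrow> (\<exists>\<epsilon>>0. {x \<in> topspace \<tau>. s i x < \<epsilon>} \<subseteq> U)))"

lemma openin_gauge_topology:
  "openin (gauge_topology \<tau> k a s) U \<longleftrightarrow> openin \<tau> U \<and>
    (\<forall>i\<in>{1..k}. a i \<in> U \<longrightarrow> (\<exists>\<epsilon>>0. {x \<in> topspace \<tau>. s i x < \<epsilon>} \<subseteq> U))"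
proof -
  let ?P = "\<lambda>U. openin \<tau> U \<and>
    (\<forall>i\<in>{1..k}. a i \<in> U \<longrightarrow> (\<exists>\<epsilon>>0. {x \<in> topspace \<tau>. s i x < \<epsilon>} \<subseteq> U))"
  have "?P (S \<inter> T)" if S: "?P S" and T: "?P T" for S T
  proof (intro conjI ballI impI)
    show "openin \<tau> (S \<inter> T)" using S T by blast
    fix i assume i: "i \<in> {1..k}" "a i \<in> S \<inter> T"
    obtain d where d: "d > 0" "{x \<in> topspace \<tau>. s i x < d} \<subseteq> S" using S i by blast
    obtain e where e: "e > 0" "{x \<in> topspace \<tau>. s i x < e} \<subseteq> T" using T i by blast
    have "min d e > 0" "{x \<in> topspace \<tau>. s i x < min d e} \<subseteq> S \<inter> T" using d e by auto
    then show "\<exists>\<epsilon>>0. {x \<in> topspace \<tau>. s i x < \<epsilon>} \<subseteq> S \<inter> T" by blast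
  qed
  moreover have "?P (\<Union>\<K>)" if K: "\<forall>S\<in>\<K>. ?P S" for \<K>
  proof (intro conjI ballI impI)
    show "openin \<tau> (\<Union>\<K>)" using K by blast
    fix i assume i: "i \<in> {1..k}" "a i \<in> \<Union>\<K>"
    then obtain S where "S \<in> \<K>" "a i \<in> S" by blast
    with K i obtain e where "e > 0" "{x \<in> topspace \<tau>. s i x < e} \<subseteq> S" by blast
    with \<open>S \<in> \<K>\<close> show "\<exists>\<epsilon>>0. {x \<in> topspace \<tau>. s i x < \<epsilon>} \<subseteq> \<Union>\<K>" by blast
  qed
  ultimately have "istopology ?P" unfolding istopology_def by blast
  then show ?thesis unfolding gauge_topology_def by (simp add: topology_inverse')
qed

lemma topspace_gauge_topology [simp]: "topspace (gauge_topology \<tau> k a s) = topspace \<tau>"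
proof (rule antisym)
  show "topspace (gauge_topology \<tau> k a s) \<subseteq> topspace \<tau>"
    by (metis openin_gauge_topology openin_subset openin_topspace)
  have "openin (gauge_topology \<tau> k a s) (topspace \<tau>)"
    unfolding openin_gauge_topology using zero_less_one by blast
  then show "topspace \<tau> \<subseteq> topspace (gauge_topology \<tau> k a s)" by (rule openin_subset)
qed

end

theory Submission
  imports Defs
begin

text \<open>
  Everything about incompatibility reduces to four infima. Since \<open>max\<close> distributes over \<open>min\<close>,
  and an infimum of pointwise minima is the minimum of the infima, \<open>INF max(m\<^sub>i, m\<^sub>j)\<close> is the
  minimum of the infima of \<open>max(s\<^sub>i, s\<^sub>j)\<close>, \<open>max(t\<^sub>i, t\<^sub>j)\<close>, \<open>max(s\<^sub>i, t\<^sub>j)\<close> and \<open>max(t\<^sub>i, s\<^sub>j)\<close>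
  (\<open>INF_max_min_eq\<close>). Compatibility of \<open>s\<close> and of \<open>t\<close> makes the first two positive, so
  incompatibility of \<open>m\<close> is the vanishing of one of the two mixed infima. For a nonnegative function,
  a zero infimum is a limit \<open>0\<close> along some sequence (\<open>INF_eq_0_iff_sequence\<close>), and
  a maximum of nonnegative terms tends to \<open>0\<close> exactly when both terms do. The case distinction between
  the four maxima is thus made once, on infima, instead of term by term along a sequence.

  For the reformulation by gauge topologies (\<open>limitin_gauge_topology_iff\<close>), the small sublevel sets of
  \<open>s\<^sub>i\<close> form a neighbourhood base of \<open>a\<^sub>i\<close> in \<open>\<tau>\<^sub>s\<close>. By definition each neighbourhood of \<open>a\<^sub>i\<close>
  contains one. Conversely, once a sublevel set of \<open>s\<^sub>i\<close> is so small that it avoids the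
  finitely many other points \<open>a\<^sub>j\<close>, it is open in \<open>\<tau>\<^sub>s\<close>, because the only gauge condition left to
  check is the one at \<open>a\<^sub>i\<close>.
\<close>

section \<open>Infima of nonnegative functions\<close>

lemma INF_eq_0_iff_sequence:
  fixes f :: "'a \<Rightarrow> real"
  assumes "A \<noteq> {}" and nonneg: "\<And>x. x \<in> A \<Longrightarrow> 0 \<le> f x"
  shows "(INF x\<in>A. f x) = 0 \<longleftrightarrow>
    (\<exists>x :: nat \<Rightarrow> 'a. range x \<subseteq> A \<and> (\<lambda>n. f (x n)) \<longlonglongrightarrow> 0)"
proof
  have bdd: "bdd_below (f ` A)"
    using nonneg by (intro bdd_belowI2[where m = 0])
  {
    assume inf0: "(INF x\<in>A. f x) = 0"
    have "\<exists>y\<in>A. f y < inverse (real (Suc n))" for n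
    proof -
      have "(INF x\<in>A. f x) < inverse (real (Suc n))"
        by (simp add: inf0)
      then show ?thesis
        using cINF_less_iff[OF \<open>A \<noteq> {}\<close> bdd] by blast
    qed
    then obtain x where x: "\<And>n. x n \<in> A" "\<And>n. f (x n) < inverse (real (Suc n))"
      by metis
    have "(\<lambda>n. f (x n)) \<longlonglongrightarrow> 0"
      by (rule tendsto_sandwich[OF _ _ tendsto_const LIMSEQ_inverse_real_of_nat])
        (use x nonneg in \<open>auto intro!: always_eventually less_imp_le\<close>)
    with x show "\<exists>x :: nat \<Rightarrow> 'a. range x \<subseteq> A \<and> (\<lambda>n. f (x n)) \<longlonglongrightarrow> 0"
      by blast
  next
    assume "\<exists>x :: nat \<Rightarrow> 'a. range x \<subseteq> A \<and> (\<lambda>n. f (x n)) \<longlonglongrightarrow> 0"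
    then obtain x :: "nat \<Rightarrow> 'a" where x: "range x \<subseteq> A" "(\<lambda>n. f (x n)) \<longlonglongrightarrow> 0"
      by blast
    have "(INF x\<in>A. f x) \<le> 0"
      by (rule LIMSEQ_le_const[OF x(2)]) (use x(1) bdd in \<open>auto intro!: cINF_lower\<close>)
    moreover have "0 \<le> (INF x\<in>A. f x)"
      by (rule cINF_greatest) (use assms in auto)
    ultimately show "(INF x\<in>A. f x) = 0"
      by simp
  }
qed

lemma tendsto_max_0_iff:
  fixes f g :: "'a \<Rightarrow> real"
  assumes f: "\<And>x. 0 \<le> f x" and g: "\<And>x. 0 \<le> g x"
  shows "((\<lambda>x. max (f x) (g x)) \<longlongrightarrow> 0) F \<longleftrightarrow> (f \<longlongrightarrow> 0) F \<and> (g \<longlongrightarrow> 0) F"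
proof
  assume lim: "((\<lambda>x. max (f x) (g x)) \<longlongrightarrow> 0) F"
  have "(f \<longlongrightarrow> 0) F"
    by (rule tendsto_sandwich[OF _ _ tendsto_const lim]) (use f in auto)
  moreover have "(g \<longlongrightarrow> 0) F"
    by (rule tendsto_sandwich[OF _ _ tendsto_const lim]) (use g in auto)
  ultimately show "(f \<longlongrightarrow> 0) F \<and> (g \<longlongrightarrow> 0) F" ..
next
  assume "(f \<longlongrightarrow> 0) F \<and> (g \<longlongrightarrow> 0) F"
  then show "((\<lambda>x. max (f x) (g x)) \<longlongrightarrow> 0) F"
    using tendsto_max[of f 0 F g 0] by simp
qed

lemma INF_max_eq_0_iff_sequence:
  fixes f g :: "'a \<Rightarrow> real"
  assumes "A \<noteq> {}" and "\<And>x. x \<in> A \<Longrightarrow> 0 \<le> f x" and "\<And>x. x \<in> A \<Longrightarrow> 0 \<le> g x"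
  shows "(INF x\<in>A. max (f x) (g x)) = 0 \<longleftrightarrow>
    (\<exists>x :: nat \<Rightarrow> 'a. range x \<subseteq> A \<and> (\<lambda>n. f (x n)) \<longlonglongrightarrow> 0 \<and> (\<lambda>n. g (x n)) \<longlonglongrightarrow> 0)"
proof -
  have "(\<lambda>n. max (f (x n)) (g (x n))) \<longlonglongrightarrow> 0 \<longleftrightarrow>
      (\<lambda>n. f (x n)) \<longlonglongrightarrow> 0 \<and> (\<lambda>n. g (x n)) \<longlonglongrightarrow> 0" if "range x \<subseteq> A" for x :: "nat \<Rightarrow> 'a"
    by (rule tendsto_max_0_iff) (use that assms in auto)
  moreover have "(INF x\<in>A. max (f x) (g x)) = 0 \<longleftrightarrow>
      (\<exists>x :: nat \<Rightarrow> 'a. range x \<subseteq> A \<and> (\<lambda>n. max (f (x n)) (g (x n))) \<longlonglongrightarrow> 0)"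
    by (rule INF_eq_0_iff_sequence) (use assms in \<open>auto simp: le_max_iff_disj\<close>)
  ultimately show ?thesis
    by blast
qed

lemma INF_min_distrib:
  fixes f g :: "'a \<Rightarrow> real"
  assumes "A \<noteq> {}" and "bdd_below (f ` A)" and "bdd_below (g ` A)"
  shows "(INF x\<in>A. min (f x) (g x)) = min (INF x\<in>A. f x) (INF x\<in>A. g x)"
  using cINF_inf_distrib[OF assms] by (simp add: inf_min)

text \<open>
  Distributivity writes the maximum of two minima as a minimum of four maxima, and the infimum passes
  to each of these. In the application \<open>f, g\<close> come from one gauge system and \<open>f', g'\<close> from another, so
  that the terms split into two unmixed ones, governed by compatibility, and two mixed ones.
\<close>

lemma INF_max_min_eq:
  fixes f f' g g' :: "'a \<Rightarrow> real"
  assumes "A \<noteq> {}"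
    and "\<And>x. x \<in> A \<Longrightarrow> 0 \<le> f x" and "\<And>x. x \<in> A \<Longrightarrow> 0 \<le> f' x"
    and "\<And>x. x \<in> A \<Longrightarrow> 0 \<le> g x" and "\<And>x. x \<in> A \<Longrightarrow> 0 \<le> g' x"
  shows "(INF x\<in>A. max (min (f x) (f' x)) (min (g x) (g' x))) =
    min (min (INF x\<in>A. max (f x) (g x)) (INF x\<in>A. max (f' x) (g' x)))
        (min (INF x\<in>A. max (f x) (g' x)) (INF x\<in>A. max (f' x) (g x)))"
proof -
  have bdd: "bdd_below (h ` A)" if "\<And>x. x \<in> A \<Longrightarrow> 0 \<le> h x" for h :: "'a \<Rightarrow> real"
    using that by (intro bdd_belowI2[where m = 0])
  have "max (min (f x) (f' x)) (min (g x) (g' x)) =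
      min (min (max (f x) (g x)) (max (f' x) (g' x))) (min (max (f x) (g' x)) (max (f' x) (g x)))" for x
    by (simp add: min_def max_def)
  then show ?thesis
    using assms by (simp add: INF_min_distrib bdd le_max_iff_disj)
qed

section \<open>Gauge systems and their topologies\<close>

lemma compatible_gauge_systemsD:
  assumes "s \<in> compatible_gauge_systems \<tau> k a" and "i \<in> {1..k}"
  shows "continuous_map \<tau> euclideanreal (s i)"
    and "x \<in> topspace \<tau> \<Longrightarrow> 0 \<le> s i x"
    and "x \<in> topspace \<tau> \<Longrightarrow> s i x = 0 \<longleftrightarrow> x = a i"
    and "j \<in> {1..k} \<Longrightarrow> i \<noteq> j \<Longrightarrow> 0 < (INF x\<in>topspace \<tau>. max (s i x) (s j x))"
proof -
  have cont: "continuous_map \<tau> (top_of_set {0..1}) (s i)"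
    and zero: "{x \<in> topspace \<tau>. s i x = 0} = {a i}"
    using assms by (auto simp: compatible_gauge_systems_def)
  from cont show "continuous_map \<tau> euclideanreal (s i)"
    by (simp add: continuous_map_in_subtopology)
  from cont show "x \<in> topspace \<tau> \<Longrightarrow> 0 \<le> s i x"
    by (auto simp: continuous_map_in_subtopology)
  from zero show "x \<in> topspace \<tau> \<Longrightarrow> s i x = 0 \<longleftrightarrow> x = a i"
    by blast
  show "j \<in> {1..k} \<Longrightarrow> i \<noteq> j \<Longrightarrow> 0 < (INF x\<in>topspace \<tau>. max (s i x) (s j x))"
    using assms by (auto simp: compatible_gauge_systems_def)
qed

lemma openin_gauge_topology_sublevel:
  assumes s: "s \<in> compatible_gauge_systems \<tau> k a" and i: "i \<in> {1..k}" and "0 < \<epsilon>"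
    and avoid: "\<And>j. j \<in> {1..k} \<Longrightarrow> j \<noteq> i \<Longrightarrow> \<epsilon> \<le> s i (a j)"
  shows "openin (gauge_topology \<tau> k a s) {x \<in> topspace \<tau>. s i x < \<epsilon>}"
  unfolding openin_gauge_topology
proof (intro conjI ballI impI)
  have "openin \<tau> {x \<in> topspace \<tau>. s i x \<in> {..<\<epsilon>}}"
    by (rule openin_continuous_map_preimage[OF compatible_gauge_systemsD(1)[OF s i]]) simp
  then show "openin \<tau> {x \<in> topspace \<tau>. s i x < \<epsilon>}"
    by simp
next
  fix j assume j: "j \<in> {1..k}" and "a j \<in> {x \<in> topspace \<tau>. s i x < \<epsilon>}"
  then have "j = i"
    using avoid[OF j] by force
  with \<open>0 < \<epsilon>\<close> show "\<exists>\<delta>>0. {x \<in> topspace \<tau>. s j x < \<delta>} \<subseteq> {x \<in> topspace \<tau>. s i x < \<epsilon>}"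
    by blast
qed

text \<open>
  The gauge \<open>s\<^sub>i\<close> measures closeness to \<open>a\<^sub>i\<close> in \<open>\<tau>\<^sub>s\<close>. The sublevel set for a given radius may contain
  another point \<open>a\<^sub>j\<close> without containing a sublevel set of \<open>s\<^sub>j\<close>, and then it need not be open in \<open>\<tau>\<^sub>s\<close>;
  the radius is therefore lowered below the positive numbers \<open>s\<^sub>i(a\<^sub>j)\<close>, of which there are finitely many.
\<close>

lemma limitin_gauge_topology_iff:
  assumes s: "s \<in> compatible_gauge_systems \<tau> k a" and i: "i \<in> {1..k}"
    and inj: "inj_on a {1..k}" and a: "a ` {1..k} \<subseteq> topspace \<tau>"
    and x: "range x \<subseteq> topspace \<tau>"
  shows "limitin (gauge_topology \<tau> k a s) x (a i) F \<longleftrightarrow> ((\<lambda>n. s i (x n)) \<longlongrightarrow> 0) F"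
proof
  assume lim: "limitin (gauge_topology \<tau> k a s) x (a i) F"
  show "((\<lambda>n. s i (x n)) \<longlongrightarrow> 0) F"
  proof (rule order_tendstoI)
    fix r :: real assume "r < 0"
    then show "\<forall>\<^sub>F n in F. r < s i (x n)"
      using x compatible_gauge_systemsD(2)[OF s i] by (force intro: always_eventually less_le_trans)
  next
    fix r :: real assume "0 < r"
    define \<epsilon> where "\<epsilon> = Min (insert r ((\<lambda>j. s i (a j)) ` ({1..k} - {i})))"
    have "0 < s i (a j)" if j: "j \<in> {1..k}" "j \<noteq> i" for j
    proof -
      have "a j \<in> topspace \<tau>" and "a j \<noteq> a i"
        using j i a inj by (auto dest: inj_onD)
      then show ?thesis
        using compatible_gauge_systemsD(2,3)[OF s i, of "a j"] by linarith
    qed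
    with \<open>0 < r\<close> have "0 < \<epsilon>"
      by (auto simp: \<epsilon>_def)
    let ?U = "{y \<in> topspace \<tau>. s i y < \<epsilon>}"
    have "openin (gauge_topology \<tau> k a s) ?U"
      using \<open>0 < \<epsilon>\<close> by (intro openin_gauge_topology_sublevel[OF s i]) (auto simp: \<epsilon>_def)
    moreover have "a i \<in> ?U"
    proof -
      have "a i \<in> topspace \<tau>"
        using a i by blast
      then show ?thesis
        using compatible_gauge_systemsD(3)[OF s i, of "a i"] \<open>0 < \<epsilon>\<close> by simp
    qed
    ultimately have "\<forall>\<^sub>F n in F. x n \<in> ?U"
      using lim unfolding limitin_def by blast
    moreover have "\<epsilon> \<le> r"
      by (simp add: \<epsilon>_def)
    ultimately show "\<forall>\<^sub>F n in F. s i (x n) < r"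
      by (auto elim: eventually_mono)
  qed
next
  assume lim: "((\<lambda>n. s i (x n)) \<longlongrightarrow> 0) F"
  show "limitin (gauge_topology \<tau> k a s) x (a i) F"
    unfolding limitin_def
  proof (intro conjI allI impI)
    show "a i \<in> topspace (gauge_topology \<tau> k a s)"
      using a i by auto
    fix U assume "openin (gauge_topology \<tau> k a s) U \<and> a i \<in> U"
    then obtain \<epsilon> where "0 < \<epsilon>" and sub: "{y \<in> topspace \<tau>. s i y < \<epsilon>} \<subseteq> U"
      using i unfolding openin_gauge_topology by blast
    have "\<forall>\<^sub>F n in F. s i (x n) < \<epsilon>"
      using lim \<open>0 < \<epsilon>\<close> by (rule order_tendstoD)
    then show "\<forall>\<^sub>F n in F. x n \<in> U"
      by (rule eventually_mono) (use sub x in auto)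
  qed
qed

section \<open>Incompatibility of the minimum system\<close>

text \<open>
  Compatibility of \<open>s\<close> and of \<open>t\<close> keeps the two unmixed infima away from \<open>0\<close>, which leaves the mixed
  ones as the only source of incompatibility.
\<close>

lemma INF_min_system_eq_0_iff:
  assumes s: "s \<in> compatible_gauge_systems \<tau> k a" and t: "t \<in> compatible_gauge_systems \<tau> k a"
    and i: "i \<in> {1..k}" and j: "j \<in> {1..k}" and "i \<noteq> j" and ne: "topspace \<tau> \<noteq> {}"
  shows "(INF x\<in>topspace \<tau>. max (min_system s t i x) (min_system s t j x)) = 0 \<longleftrightarrow>
    (INF x\<in>topspace \<tau>. max (s i x) (t j x)) = 0 \<or> (INF x\<in>topspace \<tau>. max (t i x) (s j x)) = 0"
proof -
  note nonneg = compatible_gauge_systemsD(2)[OF s i] compatible_gauge_systemsD(2)[OF s j]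
    compatible_gauge_systemsD(2)[OF t i] compatible_gauge_systemsD(2)[OF t j]
  have "0 < (INF x\<in>topspace \<tau>. max (s i x) (s j x))" "0 < (INF x\<in>topspace \<tau>. max (t i x) (t j x))"
    using compatible_gauge_systemsD(4)[OF s i j \<open>i \<noteq> j\<close>]
      compatible_gauge_systemsD(4)[OF t i j \<open>i \<noteq> j\<close>] .
  moreover have "0 \<le> (INF x\<in>topspace \<tau>. max (s i x) (t j x))"
    by (rule cINF_greatest[OF ne]) (simp add: nonneg le_max_iff_disj)
  moreover have "0 \<le> (INF x\<in>topspace \<tau>. max (t i x) (s j x))"
    by (rule cINF_greatest[OF ne]) (simp add: nonneg le_max_iff_disj)
  moreover have "(INF x\<in>topspace \<tau>. max (min_system s t i x) (min_system s t j x)) =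
      min (min (INF x\<in>topspace \<tau>. max (s i x) (s j x)) (INF x\<in>topspace \<tau>. max (t i x) (t j x)))
          (min (INF x\<in>topspace \<tau>. max (s i x) (t j x)) (INF x\<in>topspace \<tau>. max (t i x) (s j x)))"
    unfolding min_system_def by (rule INF_max_min_eq[OF ne]) (simp_all add: nonneg)
  ultimately show ?thesis
    by linarith
qed

theorem lemma5p3:
  fixes \<tau> :: "'a topology" and k :: nat and a :: "nat \<Rightarrow> 'a"
    and s t :: "nat \<Rightarrow> 'a \<Rightarrow> real"
  assumes "metrizable_space \<tau>"
    and "2 \<le> k"
    and "inj_on a {1..k}"
    and "a ` {1..k} \<subseteq> topspace \<tau>"
    and "s \<in> compatible_gauge_systems \<tau> k a"
    and "t \<in> compatible_gauge_systems \<tau> k a"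
  shows "(incompatible_system \<tau> k (min_system s t) \<longleftrightarrow>
      (\<exists>i\<in>{1..k}. \<exists>j\<in>{1..k}. i \<noteq> j \<and>
        (\<exists>x :: nat \<Rightarrow> 'a. range x \<subseteq> topspace \<tau> \<and>
          ((\<lambda>n. s i (x n)) \<longlonglongrightarrow> 0 \<and> (\<lambda>n. t j (x n)) \<longlonglongrightarrow> 0
            \<or> (\<lambda>n. t i (x n)) \<longlonglongrightarrow> 0 \<and> (\<lambda>n. s j (x n)) \<longlonglongrightarrow> 0))))
    \<and> (\<forall>i\<in>{1..k}. \<forall>j\<in>{1..k}. i \<noteq> j \<longrightarrow>
      (\<forall>x :: nat \<Rightarrow> 'a. range x \<subseteq> topspace \<tau> \<longrightarrow>
        ((\<lambda>n. s i (x n)) \<longlonglongrightarrow> 0 \<and> (\<lambda>n. t j (x n)) \<longlonglongrightarrow> 0 \<longleftrightarrow>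
          limitin (gauge_topology \<tau> k a s) x (a i) sequentially \<and>
          limitin (gauge_topology \<tau> k a t) x (a j) sequentially)))"
proof -
  have ne: "topspace \<tau> \<noteq> {}"
    using assms(2,4) by (auto simp: subset_eq)
  have mixed: "(INF x\<in>topspace \<tau>. max (u i x) (v j x)) = 0 \<longleftrightarrow>
      (\<exists>x :: nat \<Rightarrow> 'a. range x \<subseteq> topspace \<tau> \<and> (\<lambda>n. u i (x n)) \<longlonglongrightarrow> 0 \<and> (\<lambda>n. v j (x n)) \<longlonglongrightarrow> 0)"
    if "u \<in> compatible_gauge_systems \<tau> k a" "v \<in> compatible_gauge_systems \<tau> k a"
      "i \<in> {1..k}" "j \<in> {1..k}" for u v i j
    using that by (intro INF_max_eq_0_iff_sequence[OF ne] compatible_gauge_systemsD(2))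
  have zero_iff: "(INF x\<in>topspace \<tau>. max (min_system s t i x) (min_system s t j x)) = 0 \<longleftrightarrow>
      (\<exists>x :: nat \<Rightarrow> 'a. range x \<subseteq> topspace \<tau> \<and>
        ((\<lambda>n. s i (x n)) \<longlonglongrightarrow> 0 \<and> (\<lambda>n. t j (x n)) \<longlonglongrightarrow> 0
          \<or> (\<lambda>n. t i (x n)) \<longlonglongrightarrow> 0 \<and> (\<lambda>n. s j (x n)) \<longlonglongrightarrow> 0))"
    if ij: "i \<in> {1..k}" "j \<in> {1..k}" "i \<noteq> j" for i j
    unfolding INF_min_system_eq_0_iff[OF assms(5,6) ij ne]
      mixed[OF assms(5,6) ij(1,2)] mixed[OF assms(6,5) ij(1,2)]
    by blast
  show ?thesis
  proof (rule conjI, goal_cases)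
    case 1
    show ?case
      unfolding incompatible_system_def by (intro bex_cong refl conj_cong zero_iff)
  next
    case 2
    show ?case
      by (intro ballI impI allI)
        (simp only: limitin_gauge_topology_iff[OF assms(5) _ assms(3,4)]
          limitin_gauge_topology_iff[OF assms(6) _ assms(3,4)])
  qed
qed

end
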